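(* Let $G$ be a finite group acting on a finite set $\mathcal{X}$, let $w:G\to(0,\infty)$ and $v:\mathcal{X}\to(0,\infty)$ be positive weights, and consider the twisted Burnside process on $\mathcal{X}$ with weights $w,v$. It is a reversible Markov chain with stationary distribution $$\pi(x)\propto W(x)v(x),\qquad x\in\mathcal{X}.$$ Moreover, if $w$ is constant on each conjugacy class of $G$ and $v$ is constant on each orbit of $\mathcal{X}$ under the action of $G$, then the chain can be lumped onto the orbits of $\mathcal{X}$, and, writing $O_x$ for the orbit containing $x$, the lumped chain is a reversible Markov chain with stationary distribution $$\tilde\pi(O_x)\propto\frac{W(x)v(x)}{|G_x|}.$$
   Context: The action is written $x\mapsto x^g$. For $x\in\mathcal{X}$ let $G_x=\{g\in G:x^g=x\}$, and for $g\in G$ let $\mathcal{X}_g=\{x\in\mathcal{X}:x^g=x\}$. Put $W(x)=\sum_{g\in G_x}w(g)$ and $V(g)=\sum_{x\in\mathcal{X}_g}v(x)$. The twisted Burnside process is the Markov chain on $\mathcal{X}$ that, from $x$, chooses $g\in G_x$ with probability $w(g)/W(x)$; then, given $g$, chooses $y\in\mathcal{X}_g$ with probability $v(y)/V(g)$; and moves from $x$ to $y$. A chain with transition matrix $K$ is reversible with respect to $\pi$ if $\pi(x)K(x,y)=\pi(y)K(y,x)$ for all $x,y$. The chain can be lumped onto orbits if, for every orbit $O$, the sum $\sum_{q\in O}K(x,q)$ depends only on the orbit of $x$; the lumped chain is then the Markov chain on the set of orbits with transition probability from $O_x$ to $O$ equal to $\sum_{q\in O}K(x,q)$. The symbol $\propto$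 means equality up to a normalizing constant making the right-hand side a probability distribution (on $\mathcal{X}$, respectively on the set of orbits). *)

theory Defs
  imports Complex_Main "HOL-Algebra.Group_Action"
begin

definition distribution_on :: "'s set \<Rightarrow> ('s \<Rightarrow> real) \<Rightarrow> bool" where
  "distribution_on S p \<longleftrightarrow> (\<forall>x\<in>S. 0 \<le> p x) \<and> (\<Sum>x\<in>S. p x) = 1"

definition markov_chain_on :: "'s set \<Rightarrow> ('s \<Rightarrow> 's \<Rightarrow> real) \<Rightarrow> bool" where
  "markov_chain_on S K \<longleftrightarrow> (\<forall>x\<in>S. distribution_on S (K x))"

definition stationary_on :: "'s set \<Rightarrow> ('s \<Rightarrow> 's \<Rightarrow> real) \<Rightarrow> ('s \<Rightarrow> real) \<Rightarrow> bool" where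
  "stationary_on S K p \<longleftrightarrow>
     distribution_on S p \<and> (\<forall>y\<in>S. (\<Sum>x\<in>S. p x * K x y) = p y)"

definition reversible_on :: "'s set \<Rightarrow> ('s \<Rightarrow> 's \<Rightarrow> real) \<Rightarrow> ('s \<Rightarrow> real) \<Rightarrow> bool" where
  "reversible_on S K p \<longleftrightarrow> (\<forall>x\<in>S. \<forall>y\<in>S. p x * K x y = p y * K y x)"

definition lumpable :: "'s set set \<Rightarrow> ('s \<Rightarrow> 's \<Rightarrow> real) \<Rightarrow> bool" where
  "lumpable P K \<longleftrightarrow>
     (\<forall>B\<in>P. \<forall>A\<in>P. \<forall>x\<in>A. \<forall>y\<in>A. (\<Sum>q\<in>B. K x q) = (\<Sum>q\<in>B. K y q))"

text \<open>The common value over all \<open>x \<in> A\<close> of the probability of moving from \<open>x\<close> into \<open>B\<close>;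
  only meaningful when \<open>K\<close> is lumpable for a partition containing \<open>A\<close> and \<open>B\<close>.\<close>

definition lumped :: "('s \<Rightarrow> 's \<Rightarrow> real) \<Rightarrow> 's set \<Rightarrow> 's set \<Rightarrow> real" where
  "lumped K A B = (THE s. \<forall>x\<in>A. (\<Sum>q\<in>B. K x q) = s)"

text \<open>The point \<open>x\<^sup>g\<close> is \<open>\<phi> g x\<close>, for a library group action, which is a left action.
  A right action \<open>\<rho>\<close> becomes one by putting \<open>\<phi> g = \<rho> (inv g)\<close>; this changes neither the
  stabilizers, fixed-point sets and orbits nor, therefore, the process.\<close>

definition stab_weight ::
  "('g, 'm) monoid_scheme \<Rightarrow> ('g \<Rightarrow> 'x \<Rightarrow> 'x) \<Rightarrow> ('g \<Rightarrow> real) \<Rightarrow> 'x \<Rightarrow> real" where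
  "stab_weight G \<phi> w x = (\<Sum>g\<in>stabilizer G \<phi> x. w g)"

definition fix_weight ::
  "'x set \<Rightarrow> ('g \<Rightarrow> 'x \<Rightarrow> 'x) \<Rightarrow> ('x \<Rightarrow> real) \<Rightarrow> 'g \<Rightarrow> real" where
  "fix_weight X \<phi> v g = (\<Sum>x\<in>invariants X \<phi> g. v x)"

definition twisted_burnside ::
  "('g, 'm) monoid_scheme \<Rightarrow> 'x set \<Rightarrow> ('g \<Rightarrow> 'x \<Rightarrow> 'x) \<Rightarrow> ('g \<Rightarrow> real) \<Rightarrow> ('x \<Rightarrow> real)
     \<Rightarrow> 'x \<Rightarrow> 'x \<Rightarrow> real" where
  "twisted_burnside G X \<phi> w v x y =
     (\<Sum>g\<in>stabilizer G \<phi> x.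
        w g / stab_weight G \<phi> w x *
        (if y \<in> invariants X \<phi> g then v y / fix_weight X \<phi> v g else 0))"

definition conjugacy_class :: "('g, 'm) monoid_scheme \<Rightarrow> 'g \<Rightarrow> 'g set" where
  "conjugacy_class G g = {h \<otimes>\<^bsub>G\<^esub> g \<otimes>\<^bsub>G\<^esub> inv\<^bsub>G\<^esub> h | h. h \<in> carrier G}"

end

theory Submission
  imports Defs
begin

text \<open>
  The process factors through the bipartite relation "g fixes x" between group elements and
  points: each half-step moves to a related element of the other kind, with probability
  proportional to its weight.  A step from \<open>x\<close> to \<open>y\<close> can pass through exactly the \<open>g\<close> that fix
  both, so the kernel is
  \<open>K(x,y) = v(y) / W(x) \<cdot> \<Sum>\<^bsub>g \<in> G\<^sub>x \<inter> G\<^sub>y\<^esub> w(g) / V(g)\<close>.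
  The sum is symmetric in \<open>x\<close> and \<open>y\<close>, so \<open>W(x) v(x) K(x,y)\<close> is symmetric too: this is detailed
  balance for the weight \<open>W(x) v(x)\<close>, and detailed balance implies stationarity once the weight is
  normalized.

  When \<open>w\<close> is a class function and \<open>v\<close> is constant on orbits, transporting everything by a group
  element \<open>h\<close> changes nothing: conjugation by \<open>h\<close> maps \<open>G\<^sub>x \<inter> G\<^sub>y\<close> onto the corresponding
  intersection for \<open>h x\<close> and \<open>h y\<close>, and \<open>h\<close> maps the fixed points of \<open>g\<close> onto those of
  \<open>h g h\<^sup>-\<^sup>1\<close>.  Hence \<open>K(h x, h y) = K(x,y)\<close>.  A kernel with this invariance is lumpable onto
  orbits (\<open>lumpable_orbits_if_invariant\<close>), because \<open>h\<close> permutes each target orbit.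

  Lumping keeps reversibility: the lumped chain is reversible for the measure of the blocks
  (\<open>reversible_on_lumped\<close>).  The weight \<open>W v\<close> being constant on the orbit \<open>O\<^sub>x\<close> of \<open>x\<close>, that measure is
  \<open>|O\<^sub>x| W(x) v(x)\<close> up to normalization, and \<open>|O\<^sub>x| = |G| / |G\<^sub>x|\<close> by the orbit-stabilizer theorem;
  the factor \<open>|G|\<close> goes into the normalizing constant.
\<close>

section \<open>Reversible chains and lumping\<close>

text \<open>Summing the detailed balance equation over the source leaves a row sum of \<open>K\<close>, which is 1.\<close>

lemma stationary_on_if_reversible_on:
  assumes "markov_chain_on S K" "distribution_on S p" "reversible_on S K p"
  shows "stationary_on S K p"
proof -
  have "(\<Sum>x\<in>S. p x * K x y) = p y" if y: "y \<in> S" for y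
  proof -
    have "(\<Sum>x\<in>S. p x * K x y) = (\<Sum>x\<in>S. p y * K y x)"
      using assms(3) y by (intro sum.cong) (auto simp: reversible_on_def)
    also have "\<dots> = p y * (\<Sum>x\<in>S. K y x)"
      by (simp add: sum_distrib_left)
    finally show ?thesis
      using assms(1) y by (simp add: markov_chain_on_def distribution_on_def)
  qed
  with assms(2) show ?thesis
    by (simp add: stationary_on_def)
qed

lemma lumped_eq:
  assumes "lumpable P K" "A \<in> P" "B \<in> P" "x \<in> A"
  shows "lumped K A B = (\<Sum>q\<in>B. K x q)"
  unfolding lumped_def
proof (rule the_equality)
  show "\<forall>y\<in>A. (\<Sum>q\<in>B. K y q) = (\<Sum>q\<in>B. K x q)"
    using assms unfolding lumpable_def by blast
qed (use assms(4) in auto)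

lemma markov_chain_on_lumped:
  assumes "partition S P" "finite S" "{} \<notin> P" "lumpable P K" "markov_chain_on S K"
  shows "markov_chain_on P (lumped K)"
  unfolding markov_chain_on_def
proof
  fix A assume A: "A \<in> P"
  then obtain x where x: "x \<in> A"
    using assms(3) by fastforce
  have sub: "B \<subseteq> S" if "B \<in> P" for B
    using partition.incl[OF assms(1)] that by blast
  have K: "\<And>y. y \<in> S \<Longrightarrow> 0 \<le> K x y" "(\<Sum>y\<in>S. K x y) = 1"
    using assms(5) sub[OF A] x by (auto simp: markov_chain_on_def distribution_on_def)
  have "(\<Sum>B\<in>P. lumped K A B) = (\<Sum>B\<in>P. \<Sum>q\<in>B. K x q)"
    using lumped_eq[OF assms(4) A _ x] by simp
  also have "\<dots> = 1"
    using partition.disjoint_sum[OF assms(1,2), of "K x"] K(2) by simp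
  finally show "distribution_on P (lumped K A)"
    using sub K(1) lumped_eq[OF assms(4) A _ x]
    by (auto simp: distribution_on_def intro!: sum_nonneg)
qed

text \<open>The flow \<open>p(A) K(A,B)\<close> between two blocks is the double sum of the flows
  \<open>p(x) K(x,q)\<close> between their points, which detailed balance makes symmetric.\<close>

lemma reversible_on_lumped:
  assumes "partition S P" "lumpable P K" "reversible_on S K p"
  shows "reversible_on P (lumped K) (\<lambda>B. \<Sum>x\<in>B. p x)"
proof -
  have sub: "B \<subseteq> S" if "B \<in> P" for B
    using partition.incl[OF assms(1)] that by blast
  have flow: "(\<Sum>x\<in>A. p x) * lumped K A B = (\<Sum>x\<in>A. \<Sum>q\<in>B. p x * K x q)"
    if "A \<in> P" "B \<in> P" for A B
    using lumped_eq[OF assms(2) that] by (simp add: sum_distrib_right sum_distrib_left)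
  have "(\<Sum>x\<in>A. \<Sum>q\<in>B. p x * K x q) = (\<Sum>x\<in>B. \<Sum>q\<in>A. p x * K x q)"
    if "A \<in> P" "B \<in> P" for A B
  proof -
    have "(\<Sum>x\<in>A. \<Sum>q\<in>B. p x * K x q) = (\<Sum>x\<in>A. \<Sum>q\<in>B. p q * K q x)"
      using assms(3) sub[OF that(1)] sub[OF that(2)]
      by (intro sum.cong refl) (auto simp: reversible_on_def)
    also have "\<dots> = (\<Sum>x\<in>B. \<Sum>q\<in>A. p x * K x q)"
      by (rule sum.swap)
    finally show ?thesis .
  qed
  with flow show ?thesis
    by (simp add: reversible_on_def)
qed

lemma distribution_on_blocks:
  assumes "partition S P" "finite S" "distribution_on S p"
  shows "distribution_on P (\<lambda>B. \<Sum>x\<in>B. p x)"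
proof -
  have "0 \<le> (\<Sum>x\<in>B. p x)" if "B \<in> P" for B
    using assms(3) partition.incl[OF assms(1) that]
    by (intro sum_nonneg) (auto simp: distribution_on_def)
  then show ?thesis
    using assms(3) partition.disjoint_sum[OF assms(1,2), of p]
    by (simp add: distribution_on_def)
qed

section \<open>Kernels invariant under a group action\<close>

context group_action
begin

lemma is_group: "group G"
  using group_hom group_hom.axioms(1) by blast

lemma empty_notin_orbits: "{} \<notin> orbits G E \<phi>"
  using orbit_refl by (auto simp: orbits_def)

lemma orbits_eq_orbit:
  assumes "B \<in> orbits G E \<phi>" "x \<in> B"
  shows "x \<in> E" "B = orbit G \<phi> x"
proof -
  show x: "x \<in> E"
    using assms orbits_coverture by blast
  then have "orbit G \<phi> x \<in> orbits G E \<phi>" "x \<in> orbit G \<phi> x"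
    using orbit_refl by (auto simp: orbits_def)
  then show "B = orbit G \<phi> x"
    using assms disjoint_union by blast
qed

lemma bij_betw_orbit:
  assumes "h \<in> carrier G" "B \<in> orbits G E \<phi>"
  shows "bij_betw (\<phi> h) B B"
proof -
  interpret group G by (rule is_group)
  have B: "B \<subseteq> E"
    using assms(2) orbits_coverture by blast
  have closed: "\<phi> g x \<in> B" if "g \<in> carrier G" "x \<in> B" for g x
    using orbits_eq_orbit(2)[OF assms(2) that(2)] that(1) by (auto simp: orbit_def)
  have "y \<in> \<phi> h ` B" if y: "y \<in> B" for y
  proof (rule image_eqI)
    show "\<phi> (inv h) y \<in> B"
      using closed assms(1) y by simp
    show "y = \<phi> h (\<phi> (inv h) y)"
      using orbit_sym_aux[of "inv h" y] assms(1) y B by auto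
  qed
  then show ?thesis
    using closed[OF assms(1)] inj_on_subset[OF inj_prop[OF assms(1)] B]
    by (auto simp: bij_betw_def)
qed

lemma lumpable_orbits_if_invariant:
  assumes "\<And>h x y. h \<in> carrier G \<Longrightarrow> x \<in> E \<Longrightarrow> y \<in> E \<Longrightarrow> K (\<phi> h x) (\<phi> h y) = K x y"
  shows "lumpable (orbits G E \<phi>) K"
  unfolding lumpable_def
proof (intro ballI)
  fix B A x y
  assume B: "B \<in> orbits G E \<phi>" and A: "A \<in> orbits G E \<phi>" and x: "x \<in> A" and y: "y \<in> A"
  obtain h where h: "h \<in> carrier G" "y = \<phi> h x"
    using orbits_eq_orbit(2)[OF A x] y by (auto simp: orbit_def)
  have "(\<Sum>q\<in>B. K y q) = (\<Sum>q\<in>B. K (\<phi> h x) (\<phi> h q))"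
    unfolding h(2) using sum.reindex_bij_betw[OF bij_betw_orbit[OF h(1) B]] by metis
  also have "\<dots> = (\<Sum>q\<in>B. K x q)"
    using assms h(1) orbits_eq_orbit(1)[OF A x] orbits_eq_orbit(1)[OF B] by simp
  finally show "(\<Sum>q\<in>B. K x q) = (\<Sum>q\<in>B. K y q)"
    by simp
qed

lemma conjugate_fixes_iff:
  assumes "h \<in> carrier G" "g \<in> carrier G" "x \<in> E"
  shows "\<phi> (h \<otimes> g \<otimes> inv h) (\<phi> h x) = \<phi> h x \<longleftrightarrow> \<phi> g x = x"
proof -
  interpret group G by (rule is_group)
  have "\<phi> (h \<otimes> g \<otimes> inv h) (\<phi> h x) = \<phi> (h \<otimes> g \<otimes> inv h \<otimes> h) x"
    using assms composition_rule[of x "h \<otimes> g \<otimes> inv h" h] by simp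
  also have "h \<otimes> g \<otimes> inv h \<otimes> h = h \<otimes> g"
    using assms by (simp add: m_assoc)
  also have "\<phi> (h \<otimes> g) x = \<phi> h (\<phi> g x)"
    using assms composition_rule by simp
  finally show ?thesis
    using inj_on_eq_iff[OF inj_prop[OF assms(1)]] element_image assms by metis
qed

text \<open>Stated for two points, since the kernel sums over the elements that fix both its
  arguments; the case \<open>x = y\<close> is the conjugation of a single stabilizer.\<close>

lemma bij_betw_conjugation_stabilizers:
  assumes h: "h \<in> carrier G" and xy: "x \<in> E" "y \<in> E"
  shows "bij_betw (\<lambda>g. h \<otimes> g \<otimes> inv h) (stabilizer G \<phi> x \<inter> stabilizer G \<phi> y)
    (stabilizer G \<phi> (\<phi> h x) \<inter> stabilizer G \<phi> (\<phi> h y))"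
    (is "bij_betw ?c ?S ?T")
proof -
  interpret group G by (rule is_group)
  have "inj_on ?c ?S"
    using conjugation_is_inj[OF h] by (auto simp: inj_on_def stabilizer_def)
  moreover have "?c g \<in> ?T" if "g \<in> ?S" for g
    using that h xy conjugate_fixes_iff[of h g] by (simp add: stabilizer_def)
  moreover have "g \<in> ?c ` ?S" if g: "g \<in> ?T" for g
  proof (rule image_eqI)
    have gc: "g \<in> carrier G"
      using g by (simp add: stabilizer_def)
    show c: "g = ?c (inv h \<otimes> g \<otimes> h)"
      using conjugation_is_surj[OF h gc] by simp
    show "inv h \<otimes> g \<otimes> h \<in> ?S"
      using g c h gc xy conjugate_fixes_iff[of h "inv h \<otimes> g \<otimes> h"]
      by (simp add: stabilizer_def)
  qed
  ultimately show ?thesis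
    by (auto simp: bij_betw_def)
qed

lemma bij_betw_invariants_conjugate:
  assumes "h \<in> carrier G" "g \<in> carrier G"
  shows "bij_betw (\<phi> h) (invariants E \<phi> g) (invariants E \<phi> (h \<otimes> g \<otimes> inv h))"
proof -
  have "inj_on (\<phi> h) (invariants E \<phi> g)"
    using inj_on_subset[OF inj_prop[OF assms(1)]] by (auto simp: invariants_def)
  moreover have "\<phi> h ` invariants E \<phi> g = invariants E \<phi> (h \<otimes> g \<otimes> inv h)"
  proof (intro equalityI subsetI)
    fix y assume "y \<in> \<phi> h ` invariants E \<phi> g"
    then show "y \<in> invariants E \<phi> (h \<otimes> g \<otimes> inv h)"
      using conjugate_fixes_iff[OF assms] element_image[OF assms(1)]
      by (auto simp: invariants_def)
  next
    fix y assume y: "y \<in> invariants E \<phi> (h \<otimes> g \<otimes> inv h)"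
    then obtain x where "x \<in> E" "y = \<phi> h x"
      using surj_prop[OF assms(1)] by (auto simp: invariants_def)
    with y show "y \<in> \<phi> h ` invariants E \<phi> g"
      using conjugate_fixes_iff[OF assms] by (auto simp: invariants_def)
  qed
  ultimately show ?thesis
    by (simp add: bij_betw_def)
qed

end

section \<open>The twisted Burnside process\<close>

locale weighted_action = group_action G X \<phi>
  for G :: "('g, 'm) monoid_scheme" (structure) and X :: "'x set" and \<phi> +
  fixes w :: "'g \<Rightarrow> real" and v :: "'x \<Rightarrow> real"
  assumes finite_carrier: "finite (carrier G)"
    and finite_points: "finite X"
    and points_nonempty: "X \<noteq> {}"
    and w_pos: "g \<in> carrier G \<Longrightarrow> 0 < w g"
    and v_pos: "x \<in> X \<Longrightarrow> 0 < v x"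
begin

abbreviation "W \<equiv> stab_weight G \<phi> w"
abbreviation "V \<equiv> fix_weight X \<phi> v"
abbreviation "K \<equiv> twisted_burnside G X \<phi> w v"

lemma finite_stabilizer: "finite (stabilizer G \<phi> x)"
  using finite_carrier stabilizer_subset finite_subset by blast

lemma W_pos:
  assumes "x \<in> X"
  shows "0 < W x"
  unfolding stab_weight_def
  using finite_stabilizer stabilizer_one_closed[OF assms] stabilizer_subset w_pos
  by (intro sum_pos) auto

lemma V_pos:
  assumes "x \<in> X" "g \<in> stabilizer G \<phi> x"
  shows "0 < V g"
proof -
  have "x \<in> invariants X \<phi> g"
    using assms by (simp add: invariants_def stabilizer_def)
  then show ?thesis
    unfolding fix_weight_def using finite_points v_pos
    by (intro sum_pos) (auto simp: invariants_def)
qed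

lemma kernel_eq:
  assumes "x \<in> X" "y \<in> X"
  shows "K x y = v y / W x * (\<Sum>g\<in>stabilizer G \<phi> x \<inter> stabilizer G \<phi> y. w g / V g)"
proof -
  have "K x y = (\<Sum>g\<in>stabilizer G \<phi> x.
      if g \<in> stabilizer G \<phi> y then v y / W x * (w g / V g) else 0)"
    unfolding twisted_burnside_def
    using assms by (intro sum.cong) (auto simp: invariants_def stabilizer_def mult.commute)
  also have "\<dots> = (\<Sum>g\<in>stabilizer G \<phi> x \<inter> stabilizer G \<phi> y. v y / W x * (w g / V g))"
    using sum.inter_restrict[OF finite_stabilizer] by (rule sym)
  finally show ?thesis
    by (simp only: sum_distrib_left)
qed

lemma markov_chain: "markov_chain_on X K"
  unfolding markov_chain_on_def distribution_on_def
proof (intro ballI conjI)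
  fix x y assume x: "x \<in> X" and y: "y \<in> X"
  have "0 \<le> w g / V g" if "g \<in> stabilizer G \<phi> x" for g
    using that w_pos[of g] V_pos[OF x that] by (simp add: stabilizer_def)
  then have "0 \<le> (\<Sum>g\<in>stabilizer G \<phi> x \<inter> stabilizer G \<phi> y. w g / V g)"
    by (intro sum_nonneg) auto
  then show "0 \<le> K x y"
    unfolding kernel_eq[OF x y] using W_pos[OF x] v_pos[OF y] by simp
next
  fix x assume x: "x \<in> X"
  have step: "(\<Sum>y\<in>X. if y \<in> invariants X \<phi> g then v y / V g else 0) = 1"
    if "g \<in> stabilizer G \<phi> x" for g
  proof -
    have "(\<Sum>y\<in>X. if y \<in> invariants X \<phi> g then v y / V g else 0)
        = (\<Sum>y\<in>X \<inter> invariants X \<phi> g. v y / V g)"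
      using finite_points by (simp add: sum.inter_restrict)
    also have "X \<inter> invariants X \<phi> g = invariants X \<phi> g"
      by (auto simp: invariants_def)
    also have "(\<Sum>y\<in>invariants X \<phi> g. v y / V g) = V g / V g"
      by (simp only: fix_weight_def sum_divide_distrib)
    finally show ?thesis
      using V_pos[OF x that] by simp
  qed
  have "(\<Sum>y\<in>X. K x y) = (\<Sum>g\<in>stabilizer G \<phi> x. \<Sum>y\<in>X. w g / W x *
      (if y \<in> invariants X \<phi> g then v y / V g else 0))"
    unfolding twisted_burnside_def by (rule sum.swap)
  also have "\<dots> = (\<Sum>g\<in>stabilizer G \<phi> x. w g / W x)"
    by (intro sum.cong refl) (simp only: sum_distrib_left[symmetric] step mult_1_right)
  also have "\<dots> = W x / W x"
    by (simp only: stab_weight_def sum_divide_distrib)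
  finally show "(\<Sum>y\<in>X. K x y) = 1"
    using W_pos[OF x] by simp
qed

definition normalizing_const :: real where
  "normalizing_const = 1 / (\<Sum>x\<in>X. W x * v x)"

definition stationary_dist :: "'x \<Rightarrow> real" where
  "stationary_dist x = normalizing_const * (W x * v x)"

lemma normalizing_const_pos: "0 < normalizing_const"
  unfolding normalizing_const_def
  using finite_points points_nonempty W_pos v_pos by (auto intro!: divide_pos_pos sum_pos)

lemma distribution_stationary_dist: "distribution_on X stationary_dist"
proof -
  have "(\<Sum>x\<in>X. stationary_dist x) = normalizing_const * (\<Sum>x\<in>X. W x * v x)"
    by (simp add: stationary_dist_def sum_distrib_left)
  also have "\<dots> = 1"
    using normalizing_const_pos by (auto simp: normalizing_const_def)
  moreover have "0 \<le> stationary_dist x" if "x \<in> X" for x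
    using normalizing_const_pos W_pos[OF that] v_pos[OF that] by (simp add: stationary_dist_def)
  ultimately show ?thesis
    by (simp add: distribution_on_def)
qed

text \<open>The factor \<open>W x\<close> cancels the denominator of the kernel, leaving \<open>v x * v y\<close> times a sum
  over the elements fixing both points.\<close>

lemma reversible: "reversible_on X K stationary_dist"
  unfolding reversible_on_def
proof (intro ballI)
  fix x y assume x: "x \<in> X" and y: "y \<in> X"
  have flow: "stationary_dist a * K a b =
      normalizing_const * (v a * v b * (\<Sum>g\<in>stabilizer G \<phi> a \<inter> stabilizer G \<phi> b. w g / V g))"
    if "a \<in> X" "b \<in> X" for a b
    using kernel_eq[OF that] W_pos[OF that(1)] by (simp add: stationary_dist_def)
  show "stationary_dist x * K x y = stationary_dist y * K y x"
    using flow[OF x y] flow[OF y x] by (simp add: Int_commute mult.commute)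
qed

end

text \<open>Constancy on conjugacy classes and on orbits, put as invariance under a single group
  element, which is the form in which sums are reindexed along conjugation and along \<open>\<phi> h\<close>.\<close>

locale invariant_weighted_action = weighted_action +
  assumes w_conjugate: "h \<in> carrier G \<Longrightarrow> g \<in> carrier G \<Longrightarrow> w (h \<otimes> g \<otimes> inv h) = w g"
    and v_invariant: "h \<in> carrier G \<Longrightarrow> x \<in> X \<Longrightarrow> v (\<phi> h x) = v x"
begin

lemma W_invariant:
  assumes "h \<in> carrier G" "x \<in> X"
  shows "W (\<phi> h x) = W x"
proof -
  have "W (\<phi> h x) = (\<Sum>g\<in>stabilizer G \<phi> x. w (h \<otimes> g \<otimes> inv h))"
    using sum.reindex_bij_betw[OF bij_betw_conjugation_stabilizers[OF assms assms(2)], of w]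
    by (simp add: stab_weight_def)
  also have "\<dots> = W x"
    unfolding stab_weight_def
    using w_conjugate[OF assms(1)] stabilizer_subset by (intro sum.cong) auto
  finally show ?thesis .
qed

lemma V_conjugate:
  assumes "h \<in> carrier G" "g \<in> carrier G"
  shows "V (h \<otimes> g \<otimes> inv h) = V g"
proof -
  have "V (h \<otimes> g \<otimes> inv h) = (\<Sum>x\<in>invariants X \<phi> g. v (\<phi> h x))"
    using sum.reindex_bij_betw[OF bij_betw_invariants_conjugate[OF assms], of v]
    by (simp add: fix_weight_def)
  also have "\<dots> = V g"
    unfolding fix_weight_def
    using v_invariant[OF assms(1)] by (intro sum.cong) (auto simp: invariants_def)
  finally show ?thesis .
qed

lemma kernel_invariant:
  assumes h: "h \<in> carrier G" and x: "x \<in> X" and y: "y \<in> X"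
  shows "K (\<phi> h x) (\<phi> h y) = K x y"
proof -
  let ?S = "stabilizer G \<phi> x \<inter> stabilizer G \<phi> y"
  have "(\<Sum>g\<in>stabilizer G \<phi> (\<phi> h x) \<inter> stabilizer G \<phi> (\<phi> h y). w g / V g)
      = (\<Sum>g\<in>?S. w (h \<otimes> g \<otimes> inv h) / V (h \<otimes> g \<otimes> inv h))"
    using sum.reindex_bij_betw[OF bij_betw_conjugation_stabilizers[OF h x y],
        of "\<lambda>g. w g / V g"] by simp
  also have "\<dots> = (\<Sum>g\<in>?S. w g / V g)"
    using w_conjugate[OF h] V_conjugate[OF h]
    by (intro sum.cong) (auto simp: stabilizer_def)
  finally show ?thesis
    using kernel_eq x y element_image[OF h] W_invariant[OF h] v_invariant[OF h] by simp
qed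

lemma lumpable_orbits: "lumpable (orbits G X \<phi>) K"
  using kernel_invariant by (rule lumpable_orbits_if_invariant)

text \<open>This is where \<open>|G\<^sub>x|\<close> enters the lumped stationary distribution: the weight is constant on the
  orbit, and the size of the orbit is \<open>|G| / |G\<^sub>x|\<close>.\<close>

lemma stationary_dist_orbit:
  assumes x: "x \<in> X"
  shows "(\<Sum>y\<in>orbit G \<phi> x. stationary_dist y) =
    normalizing_const * real (order G) * (W x * v x / real (card (stabilizer G \<phi> x)))"
proof -
  have "(\<Sum>y\<in>orbit G \<phi> x. stationary_dist y) = (\<Sum>y\<in>orbit G \<phi> x. stationary_dist x)"
    using W_invariant v_invariant x
    by (intro sum.cong) (auto simp: stationary_dist_def orbit_def)
  also have "\<dots> = real (card (orbit G \<phi> x)) * stationary_dist x"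
    by simp
  also have "real (card (orbit G \<phi> x)) = real (order G) / real (card (stabilizer G \<phi> x))"
  proof -
    have "card (stabilizer G \<phi> x) \<noteq> 0"
      using finite_stabilizer stabilizer_one_closed[OF x] by auto
    moreover have "real (card (orbit G \<phi> x)) * real (card (stabilizer G \<phi> x)) = real (order G)"
      using orbit_stabilizer_theorem[OF x] by (metis of_nat_mult)
    ultimately show ?thesis
      by (simp add: field_simps)
  qed
  finally show ?thesis
    by (simp add: stationary_dist_def)
qed

end

theorem proposition4p1:
  fixes G :: "('g, 'm) monoid_scheme"
    and X :: "'x set"
    and \<phi> :: "'g \<Rightarrow> 'x \<Rightarrow> 'x"
    and w :: "'g \<Rightarrow> real"
    and v :: "'x \<Rightarrow> real"
  assumes "group_action G X \<phi>"
    and "finite (carrier G)"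
    and "finite X" and "X \<noteq> {}"
    and "\<And>g. g \<in> carrier G \<Longrightarrow> 0 < w g"
    and "\<And>x. x \<in> X \<Longrightarrow> 0 < v x"
  shows "let K = twisted_burnside G X \<phi> w v;
             Orb = orbits G X \<phi>
         in markov_chain_on X K \<and>
            (\<exists>p c. 0 < c \<and>
               (\<forall>x\<in>X. p x = c * (stab_weight G \<phi> w x * v x)) \<and>
               stationary_on X K p \<and> reversible_on X K p) \<and>
            ((\<forall>g\<in>carrier G. \<forall>a\<in>conjugacy_class G g. \<forall>b\<in>conjugacy_class G g. w a = w b) \<and>
             (\<forall>B\<in>Orb. \<forall>x\<in>B. \<forall>y\<in>B. v x = v y)
             \<longrightarrow> lumpable Orb K \<and>
                 markov_chain_on Orb (lumped K) \<and>
                 (\<exists>p c. 0 < c \<and>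
                    (\<forall>x\<in>X. p (orbit G \<phi> x) =
                       c * (stab_weight G \<phi> w x * v x / real (card (stabilizer G \<phi> x)))) \<and>
                    stationary_on Orb (lumped K) p \<and>
                    reversible_on Orb (lumped K) p))"
proof -
  interpret weighted_action G X \<phi> w v
    using assms by (simp add: weighted_action_def weighted_action_axioms_def)
  let ?Orb = "orbits G X \<phi>"
  have full: "\<exists>p c. 0 < c \<and> (\<forall>x\<in>X. p x = c * (W x * v x)) \<and>
      stationary_on X K p \<and> reversible_on X K p"
  proof (intro exI conjI)
    show "\<forall>x\<in>X. stationary_dist x = normalizing_const * (W x * v x)"
      by (simp add: stationary_dist_def)
    show "stationary_on X K stationary_dist"
      using markov_chain distribution_stationary_dist reversible
      by (rule stationary_on_if_reversible_on)
  qed (fact normalizing_const_pos reversible)+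
  have lump: "lumpable ?Orb K \<and> markov_chain_on ?Orb (lumped K) \<and>
      (\<exists>p c. 0 < c \<and>
        (\<forall>x\<in>X. p (orbit G \<phi> x) = c * (W x * v x / real (card (stabilizer G \<phi> x)))) \<and>
        stationary_on ?Orb (lumped K) p \<and> reversible_on ?Orb (lumped K) p)"
    if w: "\<forall>g\<in>carrier G. \<forall>a\<in>conjugacy_class G g. \<forall>b\<in>conjugacy_class G g. w a = w b"
      and v: "\<forall>B\<in>?Orb. \<forall>x\<in>B. \<forall>y\<in>B. v x = v y"
  proof -
    interpret group G by (rule is_group)
    interpret invariant_weighted_action G X \<phi> w v
    proof
      fix h g assume h: "h \<in> carrier G" and g: "g \<in> carrier G"
      have "g = \<one>\<^bsub>G\<^esub> \<otimes>\<^bsub>G\<^esub> g \<otimes>\<^bsub>G\<^esub> inv\<^bsub>G\<^esub> \<one>\<^bsub>G\<^esub>"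
        using g by simp
      then have "g \<in> conjugacy_class G g" "h \<otimes>\<^bsub>G\<^esub> g \<otimes>\<^bsub>G\<^esub> inv\<^bsub>G\<^esub> h \<in> conjugacy_class G g"
        unfolding conjugacy_class_def using h one_closed by blast+
      then show "w (h \<otimes>\<^bsub>G\<^esub> g \<otimes>\<^bsub>G\<^esub> inv\<^bsub>G\<^esub> h) = w g"
        using w g by blast
    next
      fix h x assume "h \<in> carrier G" and x: "x \<in> X"
      then have "\<phi> h x \<in> orbit G \<phi> x" "x \<in> orbit G \<phi> x" "orbit G \<phi> x \<in> ?Orb"
        using orbit_refl by (auto simp: orbit_def orbits_def)
      then show "v (\<phi> h x) = v x"
        using v by blast
    qed
    let ?p = "\<lambda>B. \<Sum>x\<in>B. stationary_dist x"
    have markov: "markov_chain_on ?Orb (lumped K)"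
      using orbit_partition finite_points empty_notin_orbits lumpable_orbits markov_chain
      by (rule markov_chain_on_lumped)
    have rev: "reversible_on ?Orb (lumped K) ?p"
      using orbit_partition lumpable_orbits reversible by (rule reversible_on_lumped)
    have dist: "distribution_on ?Orb ?p"
      using orbit_partition finite_points distribution_stationary_dist
      by (rule distribution_on_blocks)
    have "0 < normalizing_const * real (order G)"
      using normalizing_const_pos order_gt_0_iff_finite finite_carrier by simp
    moreover have "stationary_on ?Orb (lumped K) ?p"
      using markov dist rev by (rule stationary_on_if_reversible_on)
    ultimately show ?thesis
      using lumpable_orbits markov rev stationary_dist_orbit by blast
  qed
  show ?thesis
    unfolding Let_def using markov_chain full lump by blast
qed

end
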